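(* Let $G=(V_1,V_2,E)$ be a finite directed bipartite graph with all arcs directed from $V_1$ (senders) to $V_2$ (receivers), and let $p\in(0,1)$. Let $k\ge1$; let $V_1$ be partitioned into groups $L_1,\ldots,L_k$, each consisting of exactly one influencer and some number ($\ge 0$) of subordinates; and let $V_2$ be partitioned as $G_0\cup G_1\cup\cdots\cup G_k$ ($G_0$ possibly empty), with $n_l=|G_l|$. Assume that the influencer in $L_l$ is adjacent to all receivers in $G_l$ for each $l=1,\ldots,k$, and that no receiver in $G_0$ is adjacent to any influencer. Let $\hat n_l$ denote the number of receivers in $G_l$ that are not adjacent to any sender outside $L_l$, and let $\alpha_l,\gamma_l$ be nonnegative integers with $\alpha_l<n_l$ such that each subordinate in $L_l$ is adjacent to at most $\alpha_l$ receivers in $G_l$ and at most $\gamma_l$ receivers outside $G_l$. Suppose that for some $\xi\in\left[0,\frac1{2k+1}\right)$, $$\min_{1\le i\le k}\hat n_i\ \ge\ (1-p)^{0.5+\frac{\xi}{2}}\max_{1\le j\le k}\left\{\alpha_j+\frac{\gamma_j}{1-p}\right\}\quad\text{and}\quad n_l-\alpha_l>(1-p)^{-k}\gamma_l\ \ \text{for all } l=1,\ldots,k.$$ For $\mathbf{x}\in\mathbb{R}^{|V_1|}$ define $\mathbf{y}_\xi(\mathbf{x})\in\{0,1\}^{|V_1|}$ by $(\mathbf{y}_\xi(\mathbf{x}))_i=1$ if $x_i\ge 0.5-\frac{\xi}{2}$ and $(\mathbf{y}_\xi(\mathbf{x}))_i=0$ otherwise. Let $\mathbf{x}^*\in\{0,1\}^{|V_1|}$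 be the indicator vector of the set of the $k$ influencers. Then: (a) $\mathbf{y}_\xi(\mathbf{x}^\diamond)=\mathbf{x}^*$ for every optimal solution $\mathbf{x}^\diamond$ of the convex relaxation (R) defined in the context. (b) $\mathbf{x}^*$ is an optimal solution of the stochastic integer program (S) defined in the context.
   Context: $\mathbf{e}$ denotes the all-ones vector and $\mathbf{0}$ the zero vector, of appropriate dimension; vector inequalities are entrywise. A sender $i$ and a receiver $j$ are adjacent if $(i,j)\in E$. Independent cascade model with uniform probability $p$: a random $|V_1|\times|V_2|$ $0$-$1$ matrix $A$ is generated by including each arc $(i,j)\in E$ independently with probability $p$ (then $A_{ij}=1$); all other entries are $0$. (S) The stochastic integer program is $$\max_{\mathbf{x},\,\mathbf{t}}\ \mathbb{E}_A(\mathbf{e}^T\mathbf{t})\quad\text{s.t.}\quad \mathbf{t}\le A^T\mathbf{x},\ \ \mathbf{0}\le\mathbf{t}\le\mathbf{e},\ \ \mathbf{e}^T\mathbf{x}=k,\ \ \mathbf{x}\in\{0,1\}^{|V_1|},$$ where $\mathbf{x}$ is deterministic (chosen before $A$ is realized) and $\mathbf{t}=\mathbf{t}(A)$ may depend on $A$. Thus one maximizes, over $0$-$1$ vectors $\mathbf{x}$ with exactly $k$ ones, the expected number of receivers $j$ having at least one realized arc $(i,j)$ with $x_i=1$. "$\mathbf{x}^*$ is an optimal solution of (S)" means that $\mathbf{x}^*$ is the $\mathbf{x}$-part of an optimal solution. (R) The convex relaxation is $$\min_{\mathbf{x}\in\mathbb{R}^{|V_1|}}\ g(\mathbf{x}):=\sum_{j\in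 V_2}\ \prod_{i:(i,j)\in E}(1-p)^{x_i}\quad\text{s.t.}\quad \mathbf{e}^T\mathbf{x}=k,\ \ \mathbf{0}\le\mathbf{x}\le\mathbf{e}.$$ *)

theory Defs
  imports "HOL-Probability.Probability"
begin

text \<open>
  The senders are the elements of a finite type \<open>'s\<close>, the receivers those of a finite type \<open>'r\<close>,
  and the arcs form a set \<open>E :: ('s \<times> 'r) set\<close>. Vectors are of type \<open>real ^ 's\<close> or \<open>real ^ 'r\<close>, so
  \<open>\<le>\<close> is entrywise, \<open>1\<close> is the all-ones vector and \<open>1 \<bullet> x\<close> is the sum of the entries of \<open>x\<close>.
\<close>

definition cascade_matrix ::
    "('s::finite \<times> 'r::finite) set \<Rightarrow> real \<Rightarrow> (real ^ 'r ^ 's) pmf" where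
  "cascade_matrix E p =
     map_pmf (\<lambda>f. \<chi> i j. f (i, j)) (Pi_pmf E 0 (\<lambda>_. map_pmf of_bool (bernoulli_pmf p)))"

text \<open>
  In the stochastic program a decision is a pair \<open>(x, t)\<close>: \<open>x\<close> is fixed in advance, whereas
  \<open>t\<close> is a function of the realized matrix.
\<close>

definition sip_feasible ::
    "('s::finite \<times> 'r::finite) set \<Rightarrow> real \<Rightarrow> nat \<Rightarrow>
     (real ^ 's) \<times> (real ^ 'r ^ 's \<Rightarrow> real ^ 'r) \<Rightarrow> bool" where
  "sip_feasible E p k = (\<lambda>(x, t).
     (\<forall>A \<in> set_pmf (cascade_matrix E p). t A \<le> transpose A *v x \<and> 0 \<le> t A \<and> t A \<le> 1) \<and>
     1 \<bullet> x = real k \<and> (\<forall>i. x $ i \<in> {0, 1}))"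

definition sip_objective ::
    "('s::finite \<times> 'r::finite) set \<Rightarrow> real \<Rightarrow>
     (real ^ 's) \<times> (real ^ 'r ^ 's \<Rightarrow> real ^ 'r) \<Rightarrow> real" where
  "sip_objective E p = (\<lambda>(x, t). measure_pmf.expectation (cascade_matrix E p) (\<lambda>A. 1 \<bullet> t A))"

definition sip_optimal ::
    "('s::finite \<times> 'r::finite) set \<Rightarrow> real \<Rightarrow> nat \<Rightarrow> real ^ 's \<Rightarrow> bool" where
  "sip_optimal E p k x \<longleftrightarrow>
     (\<exists>t. is_arg_max (sip_objective E p) (sip_feasible E p k) (x, t))"

definition relax_objective ::
    "('s::finite \<times> 'r::finite) set \<Rightarrow> real \<Rightarrow> real ^ 's \<Rightarrow> real" where
  "relax_objective E p x = (\<Sum>j\<in>UNIV. \<Prod>i | (i, j) \<in> E. (1 - p) powr (x $ i))"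

definition relax_feasible :: "nat \<Rightarrow> real ^ ('s::finite) \<Rightarrow> bool" where
  "relax_feasible k x \<longleftrightarrow> 1 \<bullet> x = real k \<and> 0 \<le> x \<and> x \<le> 1"

definition relax_optimal ::
    "('s::finite \<times> 'r::finite) set \<Rightarrow> real \<Rightarrow> nat \<Rightarrow> real ^ 's \<Rightarrow> bool" where
  "relax_optimal E p k = is_arg_min (relax_objective E p) (relax_feasible k)"

definition round_vec :: "real \<Rightarrow> real ^ ('s::finite) \<Rightarrow> real ^ 's" where
  "round_vec \<xi> x = (\<chi> i. if x $ i \<ge> 1/2 - \<xi>/2 then 1 else 0)"

definition indicator_vec :: "'s::finite set \<Rightarrow> real ^ 's" where
  "indicator_vec S = (\<chi> i. indicator S i)"

definition exclusive_receivers :: "('s \<times> 'r) set \<Rightarrow> 's set \<Rightarrow> 'r set \<Rightarrow> 'r set" where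
  "exclusive_receivers E L G = {j \<in> G. \<forall>i. i \<notin> L \<longrightarrow> (i, j) \<notin> E}"

end

theory Submission
  imports Defs
begin

text \<open>
  Write \<open>s\<^sub>j = (\<Sum>i | (i, j) \<in> E. x $ i)\<close> and \<open>q = 1 - p\<close>, and let \<open>m(v)\<close> be the sum of
  \<open>q\<close> to the power \<open>s\<^sub>j\<close> over the receivers \<open>j\<close> of the sender \<open>v\<close>. Shifting weight from \<open>u\<close> to \<open>v\<close>
  lowers the relaxed objective iff \<open>m(u) < m(v)\<close>, infinitesimally for real vectors and exactly
  for a swap in a \<open>0\<close>-\<open>1\<close> vector if \<open>m\<close> is taken with \<open>u\<close> removed, so both parts compare the same
  sums \<open>m\<close>. Inside a group the influencer always
  beats a subordinate, so at an optimum a subordinate has positive weight only if its influencer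
  has weight \<open>1\<close>. If then the influencer of another group has weight \<open>z < 1\<close>, comparing it with
  a subordinate of weight \<open>y > 0\<close> gives \<open>z \<ge> 1/2 - \<xi>/2 + y\<close>; as the weights sum to \<open>k\<close>, no influencer
  falls below the threshold, and no subordinate can reach it since otherwise every influencer
  would have weight at least \<open>1 - \<xi>\<close>. For \<open>0\<close>-\<open>1\<close> vectors the expected coverage is the number of
  receivers minus the relaxed objective, and the same comparisons allow every subordinate to be
  swapped for an influencer without loss.
\<close>

section \<open>Exposure, marginals and the first-order condition\<close>

definition exposure :: "('s::finite \<times> 'r) set \<Rightarrow> real ^ 's \<Rightarrow> 'r \<Rightarrow> real" where
  "exposure E x j = (\<Sum>i | (i, j) \<in> E. x $ i)"

text \<open>
  Up to the factor \<open>ln (1 - p)\<close> this is the partial derivative of \<^const>\<open>relax_objective\<close> in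
  the direction \<open>v\<close>, and up to the factor \<open>- p\<close> its increment when \<open>x $ v\<close> grows by \<open>1\<close>.
\<close>

definition marginal :: "('s::finite \<times> 'r::finite) set \<Rightarrow> real \<Rightarrow> real ^ 's \<Rightarrow> 's \<Rightarrow> real" where
  "marginal E p x v = (\<Sum>j | (v, j) \<in> E. (1 - p) powr exposure E x j)"

lemma exposure_add: "exposure E (x + y) j = exposure E x j + exposure E y j"
  by (simp add: exposure_def sum.distrib)

lemma exposure_diff: "exposure E (x - y) j = exposure E x j - exposure E y j"
  by (simp add: exposure_def sum_subtractf)

lemma exposure_scaleR: "exposure E (c *\<^sub>R x) j = c * exposure E x j"
  by (simp add: exposure_def sum_distrib_left)

lemma exposure_axis: "exposure E (axis v 1) j = of_bool ((v, j) \<in> E)"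
  by (simp add: exposure_def axis_def)

lemma exposure_nonneg: "0 \<le> x \<Longrightarrow> 0 \<le> exposure E x j"
  by (auto simp: exposure_def less_eq_vec_def intro!: sum_nonneg)

lemma inner_one_eq_sum: "1 \<bullet> (x :: real ^ 's) = (\<Sum>i\<in>UNIV. x $ i)"
  by (simp add: inner_vec_def)

lemma sum_le_exposure:
  assumes "0 \<le> x" "\<And>i. i \<in> S \<Longrightarrow> (i, j) \<in> E"
  shows "(\<Sum>i\<in>S. x $ i) \<le> exposure E x j"
  unfolding exposure_def
  by (rule sum_mono2) (use assms in \<open>auto simp: less_eq_vec_def\<close>)

lemma exposure_le_total: "0 \<le> x \<Longrightarrow> exposure E x j \<le> 1 \<bullet> x"
  unfolding exposure_def inner_one_eq_sum
  by (rule sum_mono2) (auto simp: less_eq_vec_def)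

lemma relax_objective_eq:
  "p < 1 \<Longrightarrow> relax_objective E p x = (\<Sum>j\<in>UNIV. (1 - p) powr exposure E x j)"
  by (simp add: relax_objective_def exposure_def powr_sum)

lemma sum_of_bool_mult_eq_marginal:
  "(\<Sum>j\<in>UNIV. of_bool ((v, j) \<in> E) * (1 - p) powr exposure E x j) = marginal E p x v"
  unfolding marginal_def
  by (rule sum.mono_neutral_cong_right) auto

text \<open>Raising \<open>x $ v\<close> by one scales the term of each receiver of \<open>v\<close>
  by \<open>1 - p\<close>, which removes the fraction \<open>p\<close> of it; all other terms
  stay.\<close>

lemma relax_objective_add_axis:
  assumes "p < 1"
  shows "relax_objective E p (x + axis v 1) = relax_objective E p x - p * marginal E p x v"
proof -
  have "(1 - p) powr exposure E (x + axis v 1) j =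
      (1 - p) powr exposure E x j - p * (of_bool ((v, j) \<in> E) * (1 - p) powr exposure E x j)" for j
    using assms by (cases "(v, j) \<in> E")
      (simp_all add: exposure_add exposure_axis powr_add algebra_simps)
  then show ?thesis
    using assms
    by (simp add: relax_objective_eq sum_subtractf flip: sum_distrib_left sum_of_bool_mult_eq_marginal)
qed

text \<open>First-order optimality: \<open>u\<close> has weight to give and \<open>v\<close> has
  room, so a little weight can move from \<open>u\<close> to \<open>v\<close>. A larger marginal at
  \<open>v\<close> would make this a descent direction, because
  \<open>ln (1 - p) < 0\<close>.\<close>

lemma relax_optimal_marginal_le:
  fixes E :: "('s::finite \<times> 'r::finite) set"
  assumes p: "0 < p" "p < 1"
    and opt: "relax_optimal E p k x" and u: "x $ u > 0" and v: "x $ v < 1"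
  shows "marginal E p x v \<le> marginal E p x u"
proof (rule ccontr)
  assume less: "\<not> ?thesis"
  then have "u \<noteq> v"
    by auto
  define d :: "real ^ 's" where "d = axis v 1 - axis u 1"
  define h where "h t = relax_objective E p (x + t *\<^sub>R d)" for t
  have d: "exposure E d j = of_bool ((v, j) \<in> E) - of_bool ((u, j) \<in> E)" for j
    by (simp add: d_def exposure_diff exposure_axis)
  define l where "l = ln (1 - p) * (marginal E p x v - marginal E p x u)"
  have h_eq: "h = (\<lambda>t. \<Sum>j\<in>UNIV. (1 - p) powr (exposure E x j + t * exposure E d j))"
    using p by (simp add: h_def fun_eq_iff relax_objective_eq exposure_add exposure_scaleR)
  have "DERIV h 0 :> (\<Sum>j\<in>UNIV. exposure E d j * ln (1 - p) * (1 - p) powr exposure E x j)"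
    unfolding h_eq using p
    by (auto intro!: derivative_eq_intros sum.cong)
  also have "(\<Sum>j\<in>UNIV. exposure E d j * ln (1 - p) * (1 - p) powr exposure E x j) = l"
    unfolding l_def d sum_of_bool_mult_eq_marginal[symmetric] sum_subtractf[symmetric] sum_distrib_left
    by (intro sum.cong refl) (simp only: algebra_simps)
  finally have "DERIV h 0 :> l" .
  moreover have "l < 0"
    using less p by (auto simp: l_def intro!: mult_neg_pos)
  ultimately obtain e where e: "e > 0" "\<And>t. 0 < t \<Longrightarrow> t < e \<Longrightarrow> h t < h 0"
    using DERIV_neg_dec_right[of h l 0] by auto
  \<comment> \<open>The bound \<open>e / 2\<close> keeps the step in the range of descent; the other
    two keep the entries at \<open>u\<close> and \<open>v\<close> in the unit interval.\<close>
  define t where "t = min (e / 2) (min (x $ u) (1 - x $ v))"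
  have t: "0 < t" "t < e" "t \<le> x $ u" "t \<le> 1 - x $ v"
    using e(1) u v by (auto simp: t_def)
  have feas: "relax_feasible k x" and min: "\<And>y. relax_feasible k y \<Longrightarrow> h 0 \<le> relax_objective E p y"
    using opt by (auto simp: relax_optimal_def is_arg_min_linorder h_def)
  have "relax_feasible k (x + t *\<^sub>R d)"
    unfolding relax_feasible_def
  proof (intro conjI)
    show "1 \<bullet> (x + t *\<^sub>R d) = real k"
      using feas by (simp add: relax_feasible_def d_def inner_add_right inner_diff_right inner_axis)
    have x: "0 \<le> x $ i" "x $ i \<le> 1" for i
      using feas by (auto simp: relax_feasible_def less_eq_vec_def)
    show "0 \<le> x + t *\<^sub>R d" "x + t *\<^sub>R d \<le> 1"
      using t x \<open>u \<noteq> v\<close>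
      by (auto simp: less_eq_vec_def d_def axis_def add_nonneg_nonneg algebra_simps
            intro: order_trans[OF _ x(2)] order_trans[OF x(2)])
  qed
  from min[OF this] e(2)[OF t(1,2)] show False
    by (simp add: h_def)
qed

section \<open>The cascade matrix and the reduction of (S) to sets of senders\<close>

lemma cascade_matrix_entry:
  assumes "A \<in> set_pmf (cascade_matrix E p)"
  shows "A $ i $ j \<in> {0, 1}"
proof -
  from assms obtain f where "f \<in> set_pmf (Pi_pmf E 0 (\<lambda>_. map_pmf of_bool (bernoulli_pmf p)))"
    and A: "A = (\<chi> i j. f (i, j))"
    by (auto simp: cascade_matrix_def)
  then have "f \<in> PiE_dflt E 0 (\<lambda>_. {0, 1})"
    using set_Pi_pmf_subset'[of E 0 "\<lambda>_. map_pmf of_bool (bernoulli_pmf p)"]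
    by (force simp: PiE_dflt_def)
  then show ?thesis
    by (cases "(i, j) \<in> E") (auto simp: A PiE_dflt_def)
qed

lemma finite_set_cascade_matrix: "finite (set_pmf (cascade_matrix E p))"
  by (simp add: cascade_matrix_def set_Pi_pmf finite_PiE_dflt)

text \<open>For fixed \<open>x\<close> this is the largest \<open>t\<close> that the constraints
  admit, so that only the choice of \<open>x\<close> remains in (S).\<close>

definition covered :: "real ^ 's \<Rightarrow> real ^ 'r ^ 's \<Rightarrow> real ^ 'r" where
  "covered x A = (\<chi> j. min 1 ((transpose A *v x) $ j))"

text \<open>For 0-1 \<open>x\<close> the exposure of \<open>j\<close> counts its selected
  neighbours, and \<open>j\<close> is missed iff all their arcs fail, independently with probability
  \<open>1 - p\<close> each.\<close>

lemma expectation_covered: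
  fixes E :: "('s::finite \<times> 'r::finite) set"
  assumes p: "0 < p" "p < 1" and x: "\<And>i. x $ i \<in> {0, 1}"
  shows "measure_pmf.expectation (cascade_matrix E p) (\<lambda>A. covered x A $ j) =
    1 - (1 - p) powr exposure E x j"
proof -
  define Q where "Q = Pi_pmf E 0 (\<lambda>_. map_pmf (of_bool :: bool \<Rightarrow> real) (bernoulli_pmf p))"
  \<comment> \<open>Arcs not ending in \<open>j\<close> get the factor 1, so that the product can
    run over all of \<open>E\<close>, the index set of the product distribution.\<close>
  define F :: "'s \<times> 'r \<Rightarrow> real \<Rightarrow> real"
    where "F e y = (if snd e = j then 1 - y * x $ fst e else 1)" for e y
  \<comment> \<open>As everything is 0-1 valued, being missed is a product of independent terms, one per arc.\<close>
  have cov: "covered x (\<chi> i j. f (i, j)) $ j = 1 - (\<Prod>e\<in>E. F e (f e))" if f: "f \<in> set_pmf Q" for f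
  proof -
    have f01: "f e \<in> {0, 1}" for e
      using f cascade_matrix_entry[of "\<chi> i j. f (i, j)" E p "fst e" "snd e"]
      by (auto simp: cascade_matrix_def Q_def)
    \<comment> \<open>Off \<open>E\<close> the default value 0 applies; hence an arc with value 1
      contributes its factor to the product over \<open>E\<close>.\<close>
    have f0: "f e = 0" if "e \<notin> E" for e
      using f that set_Pi_pmf_subset[of E 0] unfolding Q_def by fastforce
    have ge0: "0 \<le> f e * x $ i" for e i
      using f01[of e] x[of i] by auto
    have T: "covered x (\<chi> i j. f (i, j)) $ j = min 1 (\<Sum>i\<in>UNIV. f (i, j) * x $ i)"
      unfolding covered_def matrix_vector_mult_def transpose_def by simp
    show ?thesis
    proof (cases "\<exists>i. f (i, j) * x $ i = 1")
      case True
      then obtain i where i: "f (i, j) * x $ i = 1"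
        by blast
      have "1 \<le> (\<Sum>i\<in>UNIV. f (i, j) * x $ i)"
        using member_le_sum[of i UNIV "\<lambda>i. f (i, j) * x $ i"] ge0 i by simp
      moreover have "(i, j) \<in> E"
        using i f0 by force
      then have "(\<Prod>e\<in>E. F e (f e)) = 0"
        using i by (intro prod_zero) (auto simp: F_def intro!: bexI[of _ "(i, j)"])
      ultimately show ?thesis
        by (simp only: T min_absorb1 diff_zero)
    next
      case False
      then have zero: "f (i, j) * x $ i = 0" for i
        using f01[of "(i, j)"] x[of i] by (metis insertE mult_1 mult_zero_left mult_zero_right singletonD)
      then have "F e (f e) = 1" for e
        by (cases e) (auto simp: F_def)
      then show ?thesis
        by (simp only: T zero) simp
    qed
  qed
  have fin: "finite (set_pmf Q)"
    by (simp add: Q_def set_Pi_pmf finite_PiE_dflt)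
  have "measure_pmf.expectation (cascade_matrix E p) (\<lambda>A. covered x A $ j) =
      measure_pmf.expectation Q (\<lambda>f. covered x (\<chi> i j. f (i, j)) $ j)"
    by (simp add: cascade_matrix_def Q_def)
  also have "\<dots> = measure_pmf.expectation Q (\<lambda>f. 1 - (\<Prod>e\<in>E. F e (f e)))"
    by (rule integral_cong_AE) (auto simp: AE_measure_pmf_iff cov)
  also have "\<dots> = 1 - measure_pmf.expectation Q (\<lambda>f. \<Prod>e\<in>E. F e (f e))"
    by (subst Bochner_Integration.integral_diff) (auto simp: integrable_measure_pmf_finite fin)
  also have "measure_pmf.expectation Q (\<lambda>f. \<Prod>e\<in>E. F e (f e)) =
      (\<Prod>e\<in>E. measure_pmf.expectation (map_pmf of_bool (bernoulli_pmf p)) (F e))"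
    unfolding Q_def
  proof (rule expectation_prod_Pi_pmf)
    fix e :: "'s \<times> 'r" and y :: real
    assume "y \<in> set_pmf (map_pmf of_bool (bernoulli_pmf p))"
    then show "0 \<le> F e y"
      using x[of "fst e"] by (auto simp: F_def)
  qed (auto intro!: integrable_measure_pmf_finite)
  \<comment> \<open>The mean of a relevant factor is \<open>1 - p * x $ fst e\<close>, which agrees
    with the power of \<open>1 - p\<close> at the exponents 0 and 1.\<close>
  also have "\<dots> = (\<Prod>e\<in>E. if snd e = j then (1 - p) powr (x $ fst e) else 1)"
  proof (rule prod.cong[OF refl])
    fix e :: "'s \<times> 'r"
    show "measure_pmf.expectation (map_pmf of_bool (bernoulli_pmf p)) (F e) =
        (if snd e = j then (1 - p) powr (x $ fst e) else 1)"
      using p x[of "fst e"] by (auto simp: F_def)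
  qed
  also have "\<dots> = (\<Prod>i | (i, j) \<in> E. (1 - p) powr (x $ i))"
    by (subst prod.inter_filter[symmetric], simp,
        rule prod.reindex_bij_witness[of _ "\<lambda>i. (i, j)" fst]) auto
  finally show ?thesis
    using p by (simp add: exposure_def powr_sum)
qed

lemma sip_objective_covered:
  fixes E :: "('s::finite \<times> 'r::finite) set"
  assumes "0 < p" "p < 1" "\<And>i. x $ i \<in> {0, 1}"
  shows "sip_objective E p (x, covered x) = CARD('r) - relax_objective E p x"
proof -
  have "sip_objective E p (x, covered x) =
      (\<Sum>j\<in>UNIV. measure_pmf.expectation (cascade_matrix E p) (\<lambda>A. covered x A $ j))"
    by (simp add: sip_objective_def inner_one_eq_sum Bochner_Integration.integral_sum
          integrable_measure_pmf_finite finite_set_cascade_matrix)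
  also have "\<dots> = CARD('r) - relax_objective E p x"
    using assms by (simp add: expectation_covered relax_objective_eq sum_subtractf)
  finally show ?thesis .
qed

lemma sip_feasible_covered:
  assumes "1 \<bullet> x = real k" "\<And>i. x $ i \<in> {0, 1}"
  shows "sip_feasible E p k (x, covered x)"
proof -
  have "0 \<le> (transpose A *v x) $ j" if "A \<in> set_pmf (cascade_matrix E p)" for A j
    unfolding matrix_vector_mult_def transpose_def
    using cascade_matrix_entry[OF that, of _ j] assms(2)
    by (auto intro!: sum_nonneg mult_nonneg_nonneg) (metis order_refl zero_le_one)+
  then show ?thesis
    using assms by (auto simp: sip_feasible_def covered_def less_eq_vec_def)
qed

lemma sip_objective_le_covered:
  assumes "sip_feasible E p k (x, t)"
  shows "sip_objective E p (x, t) \<le> sip_objective E p (x, covered x)"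
  unfolding sip_objective_def prod.case
proof (rule integral_mono_AE)
  show "AE A in cascade_matrix E p. 1 \<bullet> t A \<le> 1 \<bullet> covered x A"
    using assms
    by (auto simp: AE_measure_pmf_iff sip_feasible_def inner_one_eq_sum covered_def less_eq_vec_def
          intro!: sum_mono)
qed (auto intro!: integrable_measure_pmf_finite finite_set_cascade_matrix)

lemma zero_one_vec_eq_indicator_vec:
  assumes "\<And>i. x $ i \<in> {0, 1}"
  shows "x = indicator_vec {i. x $ i = 1}"
  using assms by (auto simp: vec_eq_iff indicator_vec_def indicator_def)

lemma inner_one_indicator_vec: "1 \<bullet> indicator_vec S = real (card S)"
  by (simp add: inner_one_eq_sum indicator_vec_def indicator_def of_bool_def[symmetric])

lemma indicator_vec_nonneg: "0 \<le> indicator_vec S"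
  by (simp add: less_eq_vec_def indicator_vec_def)

text \<open>Feasible \<open>x\<close> are indicator vectors of \<open>k\<close>-sets,
  \<open>covered\<close> is the best response to each, and the value is then a constant minus the
  relaxed objective.\<close>

lemma sip_optimal_indicator_vec:
  fixes E :: "('s::finite \<times> 'r::finite) set"
  assumes p: "0 < p" "p < 1" and S: "card S = k"
    and min: "\<And>T. card T = k \<Longrightarrow>
      relax_objective E p (indicator_vec S) \<le> relax_objective E p (indicator_vec T)"
  shows "sip_optimal E p k (indicator_vec S)"
proof -
  have ind: "indicator_vec T $ i \<in> {0, 1}" for T :: "'s set" and i
    by (simp add: indicator_vec_def indicator_def)
  have "sip_objective E p (x, t) \<le> sip_objective E p (indicator_vec S, covered (indicator_vec S))"
    if feas: "sip_feasible E p k (x, t)" for x t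
  proof -
    have "x $ i \<in> {0, 1}" for i
      using feas by (simp add: sip_feasible_def)
    then obtain T where x: "x = indicator_vec T"
      using zero_one_vec_eq_indicator_vec by blast
    have "card T = k"
      using feas by (simp add: sip_feasible_def x inner_one_indicator_vec)
    then have "sip_objective E p (x, covered x) \<le>
        sip_objective E p (indicator_vec S, covered (indicator_vec S))"
      using min p ind by (simp add: x sip_objective_covered)
    with sip_objective_le_covered[OF feas] show ?thesis
      by simp
  qed
  moreover have "sip_feasible E p k (indicator_vec S, covered (indicator_vec S))"
    using ind S by (intro sip_feasible_covered) (simp_all add: inner_one_indicator_vec)
  ultimately show ?thesis
    by (auto simp: sip_optimal_def is_arg_max_linorder intro!: exI[of _ "covered (indicator_vec S)"])
qed

section \<open>The network: influencers and subordinates\<close>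

locale influencer_network =
  fixes E :: "('s::finite \<times> 'r::finite) set"
    and p \<xi> :: real
    and k :: nat
    and L :: "nat \<Rightarrow> 's set"
    and infl :: "nat \<Rightarrow> 's"
    and G :: "nat \<Rightarrow> 'r set"
    and \<alpha> \<gamma> :: "nat \<Rightarrow> nat"
  assumes p: "0 < p" "p < 1"
    and k: "k \<ge> 1"
    and senders: "(\<Union>l\<in>{1..k}. L l) = UNIV" "disjoint_family_on L {1..k}"
    and influencer: "l \<in> {1..k} \<Longrightarrow> infl l \<in> L l"
    and influencer_adj: "l \<in> {1..k} \<Longrightarrow> j \<in> G l \<Longrightarrow> (infl l, j) \<in> E"
    and alpha_less: "l \<in> {1..k} \<Longrightarrow> \<alpha> l < card (G l)"
    and subordinate_inside:
      "l \<in> {1..k} \<Longrightarrow> i \<in> L l - {infl l} \<Longrightarrow> card {j \<in> G l. (i, j) \<in> E} \<le> \<alpha> l"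
    and subordinate_outside:
      "l \<in> {1..k} \<Longrightarrow> i \<in> L l - {infl l} \<Longrightarrow> card {j. j \<notin> G l \<and> (i, j) \<in> E} \<le> \<gamma> l"
    and xi: "0 \<le> \<xi>" "\<xi> < 1 / (2 * real k + 1)"
    and cond1:
      "real (Min ((\<lambda>i. card (exclusive_receivers E (L i) (G i))) ` {1..k})) \<ge>
       (1 - p) powr (1/2 + \<xi>/2) * Max ((\<lambda>j. real (\<alpha> j) + real (\<gamma> j) / (1 - p)) ` {1..k})"
    and cond2:
      "l \<in> {1..k} \<Longrightarrow>
         real (card (G l)) - real (\<alpha> l) > (1 - p) powi (- int k) * real (\<gamma> l)"
begin

definition influencers :: "'s set" where
  "influencers = infl ` {1..k}"

text \<open>Beside a fully selected influencer, the receivers of a subordinate inside its group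
  carry an extra factor \<open>1 - p\<close> and those outside do not. Taking this factor out of the
  whole sum divides the outside count by \<open>1 - p\<close>.\<close>

definition worst_load :: real where
  "worst_load = Max ((\<lambda>j. real (\<alpha> j) + real (\<gamma> j) / (1 - p)) ` {1..k})"

lemma inj_on_infl: "inj_on infl {1..k}"
  using influencer senders(2) by (fastforce simp: inj_on_def disjoint_family_on_def)

lemma card_influencers: "card influencers = k"
  unfolding influencers_def by (subst card_image[OF inj_on_infl]) simp

lemma infl_in_influencers: "l \<in> {1..k} \<Longrightarrow> infl l \<in> influencers"
  by (simp add: influencers_def)

lemma subordinateE:
  assumes "i \<notin> influencers"
  obtains l where "l \<in> {1..k}" "i \<in> L l - {infl l}"
proof -
  have "i \<in> (\<Union>l\<in>{1..k}. L l)"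
    using senders(1) by simp
  then obtain l where "l \<in> {1..k}" "i \<in> L l"
    by blast
  with assms infl_in_influencers[of l] that[of l] show ?thesis
    by auto
qed

lemma subordinate_not_influencer:
  assumes "l \<in> {1..k}" "i \<in> L l - {infl l}"
  shows "i \<notin> influencers"
proof
  assume "i \<in> influencers"
  then obtain m where m: "m \<in> {1..k}" "i = infl m"
    by (auto simp: influencers_def)
  then have "i \<in> L m"
    using influencer by simp
  then have "m = l"
    using assms m senders(2) by (fastforce simp: disjoint_family_on_def)
  with assms m show False
    by simp
qed

lemma sum_influencers: "(\<Sum>i\<in>influencers. f i) = (\<Sum>l\<in>{1..k}. f (infl l))"
  unfolding influencers_def by (subst sum.reindex[OF inj_on_infl]) simp

section \<open>Bounds on the marginals\<close>

lemma marginal_infl_pos: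
  assumes "l \<in> {1..k}"
  shows "0 < marginal E p x (infl l)"
proof -
  have "G l \<noteq> {}"
    using alpha_less[OF assms] by auto
  then show ?thesis
    unfolding marginal_def
    using influencer_adj[OF assms] p by (intro sum_pos) auto
qed

text \<open>Common receivers in the group cancel. Each receiver in the group that \<open>i\<close>
  misses weighs at least \<open>(1 - p) ^ k\<close>, each one of \<open>i\<close> outside at most 1,
  and \<open>cond2\<close> compares the two totals. Bounding the total weight by \<open>k\<close>
  also admits sets of \<open>k - 1\<close> senders, as the exchange argument requires.\<close>

lemma marginal_subordinate_less:
  assumes l: "l \<in> {1..k}" and i: "i \<in> L l - {infl l}"
    and x: "0 \<le> x" "1 \<bullet> x \<le> real k"
  shows "marginal E p x i < marginal E p x (infl l)"
proof -
  define w where "w j = (1 - p) powr exposure E x j" for j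
  define N where "N = {j. (i, j) \<in> E}"
  have w_nonneg: "0 \<le> w j" for j
    by (simp add: w_def)
  have w_le: "w j \<le> 1" for j
    using p exposure_nonneg[OF x(1)] by (auto simp: w_def intro!: powr_le1)
  have w_ge: "(1 - p) ^ k \<le> w j" for j
    using p exposure_le_total[OF x(1), of E j] x(2)
    by (auto simp: w_def simp flip: powr_realpow intro!: powr_mono')
  have "sum w (N - G l) \<le> \<gamma> l"
  proof -
    have "sum w (N - G l) \<le> card (N - G l)"
      using sum_bounded_above[of "N - G l" w 1] w_le by simp
    also have "\<dots> \<le> \<gamma> l"
      using subordinate_outside[OF l i] by (simp add: N_def set_diff_eq conj_commute)
    finally show ?thesis .
  qed
  also have "\<dots> < (1 - p) ^ k * (card (G l) - \<alpha> l)"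
    using cond2[OF l] alpha_less[OF l] p
    by (simp add: power_int_minus field_simps of_nat_diff)
  also have "\<dots> \<le> (1 - p) ^ k * card (G l - N)"
  proof -
    have "card (G l) = card (G l \<inter> N) + card (G l - N)"
      using card_Int_Diff[of "G l" N] by simp
    moreover have "G l \<inter> N = {j \<in> G l. (i, j) \<in> E}"
      by (auto simp: N_def)
    ultimately have "card (G l) - \<alpha> l \<le> card (G l - N)"
      using subordinate_inside[OF l i] by simp
    then show ?thesis
      using p by (intro mult_left_mono) auto
  qed
  also have "\<dots> \<le> sum w (G l - N)"
    using sum_bounded_below[of "G l - N" "(1 - p) ^ k" w] w_ge by (simp add: mult.commute)
  finally have less: "sum w (N - G l) < sum w (G l - N)" .
  have "marginal E p x i = sum w (N \<inter> G l) + sum w (N - G l)"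
    by (simp add: marginal_def w_def N_def flip: sum.Int_Diff)
  also have "\<dots> < sum w (N \<inter> G l) + sum w (G l - N)"
    using less by simp
  also have "\<dots> = sum w (G l)"
    by (simp add: sum.Int_Diff[of "G l" w N] Int_commute)
  also have "\<dots> \<le> marginal E p x (infl l)"
    unfolding marginal_def w_def[symmetric]
    using influencer_adj[OF l] w_nonneg by (intro sum_mono2) auto
  finally show ?thesis .
qed

text \<open>A receiver of \<open>i\<close> inside the group also sees the influencer, so its
  exposure is at least \<open>1 + x $ i\<close>; outside it is at least
  \<open>x $ i\<close>.\<close>

lemma marginal_subordinate_le:
  assumes l: "l \<in> {1..k}" and i: "i \<in> L l - {infl l}"
    and x: "0 \<le> x" "x $ infl l = 1"
  shows "marginal E p x i \<le> (1 - p) powr (1 + x $ i) * worst_load"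
proof -
  define w where "w j = (1 - p) powr exposure E x j" for j
  define N where "N = {j. (i, j) \<in> E}"
  have "w j \<le> (1 - p) powr (1 + x $ i)" if "j \<in> N \<inter> G l" for j
  proof -
    have "(\<Sum>i\<in>{infl l, i}. x $ i) \<le> exposure E x j"
      using that influencer_adj[OF l] x(1) by (intro sum_le_exposure) (auto simp: N_def)
    then show ?thesis
      using i x(2) p by (auto simp: w_def intro!: powr_mono')
  qed
  then have "sum w (N \<inter> G l) \<le> card (N \<inter> G l) * (1 - p) powr (1 + x $ i)"
    by (rule sum_bounded_above)
  also have "\<dots> \<le> \<alpha> l * (1 - p) powr (1 + x $ i)"
    using subordinate_inside[OF l i] by (simp add: N_def Int_def conj_commute mult_right_mono)
  finally have inside: "sum w (N \<inter> G l) \<le> \<alpha> l * (1 - p) powr (1 + x $ i)" .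
  have "w j \<le> (1 - p) powr (x $ i)" if "j \<in> N - G l" for j
  proof -
    have "(\<Sum>i\<in>{i}. x $ i) \<le> exposure E x j"
      using that x(1) by (intro sum_le_exposure) (auto simp: N_def)
    then show ?thesis
      using p by (auto simp: w_def intro!: powr_mono')
  qed
  then have "sum w (N - G l) \<le> card (N - G l) * (1 - p) powr (x $ i)"
    by (rule sum_bounded_above)
  also have "\<dots> \<le> \<gamma> l * (1 - p) powr (x $ i)"
    using subordinate_outside[OF l i]
    by (simp add: N_def set_diff_eq conj_commute mult_right_mono)
  finally have outside: "sum w (N - G l) \<le> \<gamma> l * (1 - p) powr (x $ i)" .
  have "marginal E p x i = sum w (N \<inter> G l) + sum w (N - G l)"
    by (simp add: marginal_def w_def N_def flip: sum.Int_Diff)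
  also have "\<dots> \<le> \<alpha> l * (1 - p) powr (1 + x $ i) + \<gamma> l * (1 - p) powr (x $ i)"
    using inside outside by simp
  also have "\<dots> = (1 - p) powr (1 + x $ i) * (\<alpha> l + \<gamma> l / (1 - p))"
    using p by (simp add: powr_add distrib_left mult_ac)
  also have "\<dots> \<le> (1 - p) powr (1 + x $ i) * worst_load"
    unfolding worst_load_def using l by (intro mult_left_mono Max_ge) auto
  finally show ?thesis .
qed

text \<open>Exclusive receivers of the group see no weight but that of the influencer, so their
  exposure is known exactly, and \<open>cond1\<close> bounds their number from below.\<close>

lemma marginal_infl_ge:
  assumes l: "l \<in> {1..k}" and x: "\<And>i. i \<in> L l - {infl l} \<Longrightarrow> x $ i = 0"
  shows "(1 - p) powr (1/2 + \<xi>/2 + x $ infl l) * worst_load \<le> marginal E p x (infl l)"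
proof -
  define X where "X = exclusive_receivers E (L l) (G l)"
  have exposure: "exposure E x j = x $ infl l" if "j \<in> X" for j
  proof -
    have "(infl l, j) \<in> E"
      using that influencer_adj[OF l] by (simp add: X_def exclusive_receivers_def)
    moreover have "x $ i = 0" if "(i, j) \<in> E" "i \<noteq> infl l" for i
      using x[of i] that \<open>j \<in> X\<close> by (auto simp: X_def exclusive_receivers_def)
    ultimately show ?thesis
      unfolding exposure_def by (subst sum.remove[of _ "infl l"]) auto
  qed
  have "(1 - p) powr (1/2 + \<xi>/2) * worst_load \<le> card X"
  proof -
    have "Min ((\<lambda>i. card (exclusive_receivers E (L i) (G i))) ` {1..k}) \<le> card X"
      using l by (auto simp: X_def intro!: Min_le)
    then show ?thesis
      using cond1 unfolding worst_load_def by linarith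
  qed
  then have "(1 - p) powr (1/2 + \<xi>/2 + x $ infl l) * worst_load \<le>
      card X * (1 - p) powr (x $ infl l)"
    using mult_right_mono[of _ _ "(1 - p) powr (x $ infl l)"] by (fastforce simp: powr_add mult_ac)
  also have "\<dots> = (\<Sum>j\<in>X. (1 - p) powr exposure E x j)"
    by (simp add: exposure)
  also have "\<dots> \<le> marginal E p x (infl l)"
    unfolding marginal_def using influencer_adj[OF l]
    by (intro sum_mono2) (auto simp: X_def exclusive_receivers_def)
  finally show ?thesis .
qed

lemma worst_load_nonneg: "0 \<le> worst_load"
proof -
  have "0 \<le> real (\<alpha> 1) + real (\<gamma> 1) / (1 - p)"
    using p by simp
  also have "\<dots> \<le> worst_load"
    unfolding worst_load_def using k by (intro Max_ge) auto
  finally show ?thesis .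
qed

section \<open>Optimal solutions of the relaxation\<close>

context
  fixes x
  assumes opt: "relax_optimal E p k x"
begin

lemma relax_optimal_bounds: "0 \<le> x" "0 \<le> x $ i" "x $ i \<le> 1" "1 \<bullet> x = real k"
  using opt by (auto simp: relax_optimal_def is_arg_min_linorder relax_feasible_def less_eq_vec_def)

lemma relax_optimal_infl_eq_1:
  assumes l: "l \<in> {1..k}" and i: "i \<in> L l - {infl l}" and pos: "0 < x $ i"
  shows "x $ infl l = 1"
proof (rule ccontr)
  assume "x $ infl l \<noteq> 1"
  then have "x $ infl l < 1"
    using relax_optimal_bounds(3)[of "infl l"] by simp
  from relax_optimal_marginal_le[OF p opt pos this] show False
    using marginal_subordinate_less[OF l i] relax_optimal_bounds by fastforce
qed

text \<open>The first-order condition puts the marginal of \<open>infl a\<close> below that of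
  \<open>i\<close>. Inserting the lower bound for the former and the upper bound for the latter
  leaves a comparison of exponents.\<close>

lemma relax_optimal_infl_ge:
  assumes b: "b \<in> {1..k}" and i: "i \<in> L b - {infl b}" and pos: "0 < x $ i"
    and a: "a \<in> {1..k}" and less: "x $ infl a < 1"
  shows "1/2 - \<xi>/2 + x $ i \<le> x $ infl a"
proof -
  \<comment> \<open>A subordinate of positive weight would force its influencer to weight 1.\<close>
  have zero: "x $ i' = 0" if "i' \<in> L a - {infl a}" for i'
    using relax_optimal_infl_eq_1[OF a that] less relax_optimal_bounds(2)[of i'] by fastforce
  have le: "marginal E p x (infl a) \<le> (1 - p) powr (1 + x $ i) * worst_load"
    using relax_optimal_marginal_le[OF p opt pos less]
      marginal_subordinate_le[OF b i _ relax_optimal_infl_eq_1[OF b i pos]] relax_optimal_bounds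
    by linarith
  \<comment> \<open>Otherwise the positive marginal of \<open>infl a\<close> would be at most 0; so
    \<open>worst_load\<close> may be cancelled below.\<close>
  then have "worst_load \<noteq> 0"
    using marginal_infl_pos[OF a, of x] by auto
  then have "0 < worst_load"
    using worst_load_nonneg by simp
  moreover have "(1 - p) powr (1/2 + \<xi>/2 + x $ infl a) * worst_load \<le>
      (1 - p) powr (1 + x $ i) * worst_load"
    using marginal_infl_ge[OF a zero] le by linarith
  ultimately have "(1 - p) powr (1/2 + \<xi>/2 + x $ infl a) \<le> (1 - p) powr (1 + x $ i)"
    by simp
  then have "\<not> 1/2 + \<xi>/2 + x $ infl a < 1 + x $ i"
    using p powr_less_mono'[of "1 - p"] by fastforce
  then show ?thesis
    by simp
qed

lemma relax_optimal_total:
  "real k = (\<Sum>l\<in>{1..k}. x $ infl l) + (\<Sum>i\<in>- influencers. x $ i)"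
  using relax_optimal_bounds(4) sum.Int_Diff[of UNIV "($) x" influencers]
  by (simp add: inner_one_eq_sum sum_influencers Compl_eq_Diff_UNIV)

text \<open>If \<open>infl a\<close> has weight below 1, the influencers carry less than
  \<open>k\<close> in total, so some subordinate has positive weight and
  \<open>relax_optimal_infl_ge\<close> applies.\<close>

lemma relax_optimal_infl_large:
  assumes a: "a \<in> {1..k}"
  shows "1/2 - \<xi>/2 \<le> x $ infl a"
proof (cases "x $ infl a = 1")
  case False
  then have less: "x $ infl a < 1"
    using relax_optimal_bounds(3)[of "infl a"] by simp
  then have "(\<Sum>l\<in>{1..k}. x $ infl l) < (\<Sum>l\<in>{1..k}. 1)"
    using a relax_optimal_bounds(3) by (intro sum_strict_mono_ex1) auto
  then have "(\<Sum>i\<in>- influencers. x $ i) \<noteq> 0"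
    using relax_optimal_total by auto
  then obtain i where i: "i \<notin> influencers" "x $ i \<noteq> 0"
    by (meson ComplD sum.neutral)
  then obtain b where b: "b \<in> {1..k}" "i \<in> L b - {infl b}"
    using subordinateE by blast
  have pos: "0 < x $ i"
    using i(2) relax_optimal_bounds(2)[of i] by simp
  from relax_optimal_infl_ge[OF b this a less] pos show ?thesis
    by simp
qed (use xi in simp)

lemma relax_optimal_subordinate_small:
  assumes "i \<notin> influencers"
  shows "x $ i < 1/2 - \<xi>/2"
proof (rule ccontr)
  assume "\<not> ?thesis"
  then have large: "1/2 - \<xi>/2 \<le> x $ i"
    by simp
  \<comment> \<open>This gives \<open>\<xi> < 1\<close>, which makes the threshold, and with it
    \<open>x $ i\<close>, positive.\<close>
  have "1 / (2 * real k + 1) \<le> 1"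
    by simp
  then have "\<xi> < 1"
    using xi(2) by linarith
  with large have pos: "0 < x $ i"
    by simp
  obtain b where b: "b \<in> {1..k}" "i \<in> L b - {infl b}"
    using assms subordinateE by blast
  have "1 - \<xi> \<le> x $ infl a" if a: "a \<in> {1..k}" for a
  proof (cases "x $ infl a = 1")
    case False
    then have "x $ infl a < 1"
      using relax_optimal_bounds(3)[of "infl a"] by simp
    from relax_optimal_infl_ge[OF b pos a this] large show ?thesis
      by simp
  qed (use xi in simp)
  then have "real k * (1 - \<xi>) \<le> (\<Sum>l\<in>{1..k}. x $ infl l)"
    using sum_bounded_below[of "{1..k}" "1 - \<xi>" "\<lambda>l. x $ infl l"] by simp
  moreover have "x $ i \<le> (\<Sum>i\<in>- influencers. x $ i)"
    using assms relax_optimal_bounds(2) by (intro member_le_sum) auto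
  \<comment> \<open>The influencers carry at least \<open>k * (1 - \<xi>)\<close> and
    \<open>i\<close> at least the threshold, out of a total of \<open>k\<close>. Doubling yields
    \<open>1 \<le> \<xi> * (2 * k + 1)\<close>, against the bound on \<open>\<xi>\<close>.\<close>
  ultimately have "1/2 - \<xi>/2 \<le> real k * \<xi>"
    using relax_optimal_total large by (simp add: algebra_simps)
  moreover have "\<xi> * (2 * real k + 1) < 1"
    using xi(2) by (simp add: field_simps)
  ultimately show False
    by (simp add: algebra_simps)
qed

lemma round_relax_optimal: "round_vec \<xi> x = indicator_vec influencers"
proof -
  have "1/2 - \<xi>/2 \<le> x $ i \<longleftrightarrow> i \<in> influencers" for i
    using relax_optimal_infl_large relax_optimal_subordinate_small[of i]
    by (cases "i \<in> influencers") (auto simp: influencers_def)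
  then show ?thesis
    by (simp add: round_vec_def indicator_vec_def indicator_def vec_eq_iff)
qed

end

section \<open>Exchanges between sets of \<open>k\<close> senders\<close>

text \<open>The marginals are taken at \<open>S - {i}\<close> because \<open>S\<close> and the
  swapped set both arise from it by one unit step, where \<open>relax_objective_add_axis\<close> is
  exact.\<close>

lemma improving_exchange:
  assumes S: "card S = k" and ne: "\<not> S \<subseteq> influencers"
  obtains i v where "i \<in> S - influencers" "v \<in> influencers - S"
    "marginal E p (indicator_vec (S - {i})) i \<le> marginal E p (indicator_vec (S - {i})) v"
proof (cases "\<exists>l\<in>{1..k}. \<exists>i\<in>S \<inter> (L l - {infl l}). infl l \<notin> S")
  \<comment> \<open>Some selected subordinate lacks its own influencer: swap within the
    group.\<close>
  case True
  then obtain l i where l: "l \<in> {1..k}" and i: "i \<in> L l - {infl l}" "i \<in> S" "infl l \<notin> S"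
    by blast
  have "marginal E p (indicator_vec (S - {i})) i < marginal E p (indicator_vec (S - {i})) (infl l)"
    using S i by (intro marginal_subordinate_less[OF l i(1)])
      (auto simp: inner_one_indicator_vec indicator_vec_nonneg)
  with that[of i "infl l"] i l subordinate_not_influencer[OF l i(1)] show ?thesis
    by (auto simp: infl_in_influencers)
next
  \<comment> \<open>Now a group whose influencer is missing has no selected member, and any selected
    subordinate is accompanied by its influencer, so the bounds of both marginals by
    \<open>worst_load\<close> apply.\<close>
  case False
  obtain i where i: "i \<in> S" "i \<notin> influencers"
    using ne by blast
  then obtain b where b: "b \<in> {1..k}" "i \<in> L b - {infl b}"
    using subordinateE by blast
  have "\<not> influencers \<subseteq> S"
    using card_seteq[of S influencers] S ne card_influencers by auto
  then obtain a where a: "a \<in> {1..k}" "infl a \<notin> S"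
    unfolding influencers_def by blast
  define x :: "real ^ 's" where "x = indicator_vec (S - {i})"
  have x: "x $ u = of_bool (u \<in> S - {i})" for u
    by (simp add: x_def indicator_vec_def indicator_def)
  have "infl b \<in> S"
    using False b i by blast
  then have xb: "x $ infl b = 1"
    using b by (auto simp: x)
  have xa: "x $ infl a = 0"
    using a by (simp add: x)
  have "x $ u = 0" if "u \<in> L a - {infl a}" for u
    using False a that by (auto simp: x)
  from marginal_infl_ge[of a x, OF a(1) this]
  have "(1 - p) powr (1/2 + \<xi>/2) * worst_load \<le> marginal E p x (infl a)"
    by (simp add: xa)
  moreover have "marginal E p x i \<le> (1 - p) powr 1 * worst_load"
  proof -
    have "0 \<le> x" "x $ i = 0"
      by (simp_all add: x less_eq_vec_def)
    then show ?thesis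
      using marginal_subordinate_le[OF b _ xb] by simp
  qed
  \<comment> \<open>Since \<open>\<xi> < 1\<close>, the exponent \<open>1/2 + \<xi>/2\<close> is
    below 1, and powers of \<open>1 - p\<close> decrease in the exponent.\<close>
  moreover have "(1 - p) powr 1 * worst_load \<le> (1 - p) powr (1/2 + \<xi>/2) * worst_load"
  proof -
    have "1 / (2 * real k + 1) \<le> 1"
      by simp
    then have "\<xi> < 1"
      using xi(2) by linarith
    then show ?thesis
      using p worst_load_nonneg by (intro mult_right_mono powr_mono') auto
  qed
  ultimately have "marginal E p x i \<le> marginal E p x (infl a)"
    by linarith
  with that[of i "infl a"] a i show ?thesis
    by (auto simp: x_def infl_in_influencers)
qed

text \<open>Each exchange keeps the cardinality, does not raise the objective and removes one
  non-influencer, so induction on their number ends at the influencers.\<close>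

lemma influencers_minimize:
  "card S = k \<Longrightarrow>
    relax_objective E p (indicator_vec influencers) \<le> relax_objective E p (indicator_vec S)"
proof (induction "card (S - influencers)" arbitrary: S rule: less_induct)
  case less
  show ?case
  proof (cases "S \<subseteq> influencers")
    case True
    then have "S = influencers"
      using less.prems card_influencers by (intro card_subset_eq) auto
    then show ?thesis
      by simp
  next
    case False
    with less.prems obtain i v where iv: "i \<in> S - influencers" "v \<in> influencers - S" and
      le: "marginal E p (indicator_vec (S - {i})) i \<le> marginal E p (indicator_vec (S - {i})) v"
      using improving_exchange by blast
    define T where "T = insert v (S - {i})"
    have add: "indicator_vec (insert u (S - {i})) = indicator_vec (S - {i}) + axis u 1"
      if "u \<notin> S - {i}" for u
      using that by (auto simp: vec_eq_iff indicator_vec_def axis_def indicator_def)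
    have "card T = k"
      using iv less.prems card_gt_0_iff[of S] by (auto simp: T_def card_insert_if card_Diff_singleton)
    moreover have "T - influencers = (S - influencers) - {i}"
      using iv by (auto simp: T_def)
    then have "card (T - influencers) < card (S - influencers)"
      using iv by (metis card_Diff1_less finite)
    ultimately have "relax_objective E p (indicator_vec influencers) \<le>
        relax_objective E p (indicator_vec T)"
      using less.hyps by blast
    also have "\<dots> \<le> relax_objective E p (indicator_vec (insert i (S - {i})))"
      using iv le p by (simp add: T_def add relax_objective_add_axis del: insert_Diff_single)
    also have "insert i (S - {i}) = S"
      using iv by blast
    finally show ?thesis .
  qed
qed

lemma sip_optimal_influencers: "sip_optimal E p k (indicator_vec influencers)"
  using p card_influencers influencers_minimize by (rule sip_optimal_indicator_vec)

end

theorem theorem4: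
  fixes E :: "('s::finite \<times> 'r::finite) set"
    and p \<xi> :: real
    and k :: nat
    and L :: "nat \<Rightarrow> 's set"
    and infl :: "nat \<Rightarrow> 's"
    and G :: "nat \<Rightarrow> 'r set"
    and \<alpha> \<gamma> :: "nat \<Rightarrow> nat"
  assumes p: "0 < p" "p < 1"
    and k: "k \<ge> 1"
    and senders: "(\<Union>l\<in>{1..k}. L l) = UNIV" "disjoint_family_on L {1..k}"
    and influencer: "\<And>l. l \<in> {1..k} \<Longrightarrow> infl l \<in> L l"
    and receivers: "(\<Union>l\<in>{0..k}. G l) = UNIV" "disjoint_family_on G {0..k}"
    and influencer_adj: "\<And>l j. l \<in> {1..k} \<Longrightarrow> j \<in> G l \<Longrightarrow> (infl l, j) \<in> E"
    and G0_nonadj: "\<And>l j. l \<in> {1..k} \<Longrightarrow> j \<in> G 0 \<Longrightarrow> (infl l, j) \<notin> E"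
    and alpha_less: "\<And>l. l \<in> {1..k} \<Longrightarrow> \<alpha> l < card (G l)"
    and subordinate_inside:
      "\<And>l i. l \<in> {1..k} \<Longrightarrow> i \<in> L l - {infl l} \<Longrightarrow> card {j \<in> G l. (i, j) \<in> E} \<le> \<alpha> l"
    and subordinate_outside:
      "\<And>l i. l \<in> {1..k} \<Longrightarrow> i \<in> L l - {infl l} \<Longrightarrow> card {j. j \<notin> G l \<and> (i, j) \<in> E} \<le> \<gamma> l"
    and xi: "0 \<le> \<xi>" "\<xi> < 1 / (2 * real k + 1)"
    and cond1:
      "real (Min ((\<lambda>i. card (exclusive_receivers E (L i) (G i))) ` {1..k})) \<ge>
       (1 - p) powr (1/2 + \<xi>/2) * Max ((\<lambda>j. real (\<alpha> j) + real (\<gamma> j) / (1 - p)) ` {1..k})"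
    and cond2:
      "\<And>l. l \<in> {1..k} \<Longrightarrow>
         real (card (G l)) - real (\<alpha> l) > (1 - p) powi (- int k) * real (\<gamma> l)"
  shows "(\<forall>x. relax_optimal E p k x \<longrightarrow> round_vec \<xi> x = indicator_vec (infl ` {1..k})) \<and>
    sip_optimal E p k (indicator_vec (infl ` {1..k}))"
proof -
  interpret influencer_network E p \<xi> k L infl G \<alpha> \<gamma>
    by unfold_locales (fact assms)+
  show ?thesis
    using round_relax_optimal sip_optimal_influencers by (simp add: influencers_def)
qed

end
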